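(* Let $A$ be a uniform algebra, let $\theta : A \to M_n(\mathbb{C})$ be a continuous unital homomorphism, and let $\alpha : A\to A$ be a unital antilinear contraction such that $\alpha(A) \subset \mathbb{C}1$. Define $$\theta_\alpha(f) := \tfrac12\bigl(\theta(f)+\theta(\alpha(f))^*\bigr)\quad (f \in A).$$ If $\|\theta_\alpha\| \le 1$, then $\|\theta\| \le 2$.
   Context: A uniform algebra is a norm-closed subalgebra of $C(X)$, for $X$ a compact Hausdorff space, containing the constants, with the supremum norm. $M_n(\mathbb{C})$ carries the operator norm. A map $\alpha$ is antilinear if $\alpha(\lambda f+g)=\overline\lambda\alpha(f)+\alpha(g)$. It is a contraction if $\|\alpha(f)\|\le \|f\|$, and it is unital if $\alpha(1)=1$. *)

theory Defs
  imports "HOL-Analysis.Analysis"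
begin

definition supn :: "('x \<Rightarrow> complex) \<Rightarrow> real" where
  "supn f = (SUP x. cmod (f x))"

definition uniform_algebra :: "('x::t2_space \<Rightarrow> complex) set \<Rightarrow> bool" where
  "uniform_algebra A \<longleftrightarrow>
     compact (UNIV :: 'x set) \<and>
     (\<forall>f\<in>A. continuous_on UNIV f) \<and>
     (\<forall>c. (\<lambda>x. c) \<in> A) \<and>
     (\<forall>f\<in>A. \<forall>g\<in>A. (\<lambda>x. f x + g x) \<in> A) \<and>
     (\<forall>f\<in>A. \<forall>g\<in>A. (\<lambda>x. f x * g x) \<in> A) \<and>
     (\<forall>c. \<forall>f\<in>A. (\<lambda>x. c * f x) \<in> A) \<and>
     (\<forall>F f. (\<forall>k. F k \<in> A) \<and> uniform_limit UNIV F f sequentially \<longrightarrow> f \<in> A)"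

definition cmat_scale :: "complex \<Rightarrow> complex^'n^'n \<Rightarrow> complex^'n^'n" where
  "cmat_scale c M = (\<chi> i j. c * M $ i $ j)"

definition adjoint_mat :: "complex^'n^'n \<Rightarrow> complex^'n^'n" where
  "adjoint_mat M = (\<chi> i j. cnj (M $ j $ i))"

definition mat_opnorm :: "complex^'n^'n \<Rightarrow> real" where
  "mat_opnorm M = onorm (\<lambda>v. M *v v)"

end

theory Submission
  imports Defs
begin

text \<open>
  Let \<open>K\<close> be the norm of \<open>\<theta>\<close>, finite by continuity, and suppose \<open>K > 2\<close>. If \<open>f\<close> and \<open>x\<close> have norm at
  most \<open>1\<close> and nearly attain \<open>K\<close>, put \<open>T = \<theta> f\<close>. Perturbing \<open>f\<close> along disc automorphisms to
  \<open>f - a + cnj a * f\<^sup>2\<close>, whose norm is \<open>1 + O(|a|\<^sup>2)\<close>, cannot push the norm of the image beyond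
  \<open>K (1 + O(|a|\<^sup>2))\<close>; since \<open>T\<^sup>* T x\<close> is close to \<open>K\<^sup>2 x\<close>, the first-order term is about
  \<open>(K\<^sup>2 - 1) Re \<langle>a x, T x\<rangle>\<close>, so \<open>T x\<close> is nearly orthogonal to \<open>x\<close>. As \<open>\<alpha> f\<close> is a constant, say
  \<open>cnj c\<close>, the hypothesis reads \<open>\<parallel>T x + c x\<parallel> \<le> 2\<close>, and near-orthogonality gives
  \<open>\<parallel>T x\<parallel>\<^sup>2 \<le> 4\<close> up to a small error, contradicting \<open>K > 2\<close>.
\<close>

section \<open>Scalars and matrices acting on complex vectors\<close>

lemma inner_vector_scalar_mult_left:
  fixes x y :: "complex^'n"
  shows "(c *s x) \<bullet> y = x \<bullet> (cnj c *s y)"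
  by (simp add: inner_vec_def inner_complex_def algebra_simps)

lemma norm_vector_scalar_mult:
  fixes x :: "complex^'n"
  shows "norm (c *s x) = cmod c * norm x"
  by (simp add: norm_vec_def norm_mult L2_set_right_distrib)

lemma cmat_scale_mult_vec: "cmat_scale c M *v x = c *s (M *v x)"
  by (simp add: cmat_scale_def matrix_vector_mult_def vec_eq_iff sum_distrib_left mult.assoc)

lemma adjoint_cmat_scale_one: "adjoint_mat (cmat_scale c (mat 1)) = cmat_scale (cnj c) (mat 1)"
  by (auto simp: adjoint_mat_def cmat_scale_def mat_def vec_eq_iff)

lemma bounded_linear_matrix_mult_vec:
  fixes M :: "complex^'n^'m"
  shows "bounded_linear (\<lambda>v. M *v v)"
  by (rule linear_conv_bounded_linear[THEN iffD1])
    (auto intro!: linearI simp: vec_eq_iff matrix_vector_mult_def sum.distrib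
      scaleR_sum_right algebra_simps)

lemma norm_mult_vec_le_mat_opnorm: "norm (M *v x) \<le> mat_opnorm M * norm x"
  unfolding mat_opnorm_def by (rule onorm[OF bounded_linear_matrix_mult_vec])

lemma bounded_bilinear_matrix_mult_vec:
  "bounded_bilinear (\<lambda>(M :: complex^'n^'m) x. M *v x)"
proof (rule bilinear_conv_bounded_bilinear[THEN iffD1])
  show "bilinear (\<lambda>(M :: complex^'n^'m) x. M *v x)"
    unfolding bilinear_def
    by (auto intro!: linearI simp: vec_eq_iff matrix_vector_mult_def sum.distrib
      scaleR_sum_right algebra_simps)
qed

section \<open>Vectors at which a matrix nearly attains its norm bound\<close>

text \<open>By \<open>bound\<close>, the form \<open>B\<close> of K^2 I - T* T is positive
  semidefinite, so Cauchy-Schwarz holds for it. A small defect \<open>B x x\<close> thus makes T* T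
  x close to K^2 x when tested against any y, with no adjoint or eigenvector needed.\<close>

lemma Cauchy_Schwarz_defect:
  fixes T :: "'a::real_inner \<Rightarrow> 'b::real_inner"
  assumes T: "linear T" and bound: "\<And>v. norm (T v) \<le> K * norm v"
  shows "(K\<^sup>2 * (x \<bullet> y) - T x \<bullet> T y)\<^sup>2
    \<le> (K\<^sup>2 * (norm x)\<^sup>2 - (norm (T x))\<^sup>2) * (K\<^sup>2 * (norm y)\<^sup>2 - (norm (T y))\<^sup>2)"
proof -
  define B where "B u v = K\<^sup>2 * (u \<bullet> v) - T u \<bullet> T v" for u v
  have B_nonneg: "0 \<le> B v v" for v
    using power_mono[OF bound[of v], of 2]
    by (simp add: B_def power_mult_distrib power2_norm_eq_inner)
  have quad: "B (p *\<^sub>R x + q *\<^sub>R y) (p *\<^sub>R x + q *\<^sub>R y)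
      = p\<^sup>2 * B x x + 2 * p * q * B x y + q\<^sup>2 * B y y" for p q
    by (simp add: B_def linear_add[OF T] linear_scale[OF T] inner_add_left inner_add_right
        inner_commute[of y x] inner_commute[of "T y" "T x"] algebra_simps power2_eq_square)
  have "(B x y)\<^sup>2 \<le> B x x * B y y"
  proof (cases "B y y = 0")
    case True
    have "B x y = 0"
    proof (rule ccontr)
      assume "B x y \<noteq> 0"
      \<comment> \<open>With \<open>B y y = 0\<close> the form is affine in \<open>q\<close>; this
        \<open>q\<close> gives it the value -1 at \<open>p = 1\<close>.\<close>
      then show False
        using B_nonneg[of "1 *\<^sub>R x + (- (B x x + 1) / (2 * B x y)) *\<^sub>R y"]
        unfolding quad by (simp add: True field_simps)
    qed
    then show ?thesis by (simp add: True)
  next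
    case False
    then have pos: "0 < B y y" using B_nonneg[of y] by simp
    \<comment> \<open>The usual minimiser x - (B x y / B y y) y, multiplied by \<open>B y y\<close>
      to avoid division.\<close>
    have "0 \<le> B y y * (B x x * B y y - (B x y)\<^sup>2)"
      using B_nonneg[of "B y y *\<^sub>R x + (- B x y) *\<^sub>R y"]
      unfolding quad by (simp add: algebra_simps power2_eq_square)
    then show ?thesis using pos by (simp add: zero_le_mult_iff)
  qed
  then show ?thesis by (simp add: B_def power2_norm_eq_inner)
qed

text \<open>First-order version of the Moebius map \<open>w \<mapsto> (w - a) / (1 - cnj a * w)\<close>.\<close>

lemma cmod_moebius_linearization:
  assumes w: "cmod w \<le> 1" and a: "cmod a \<le> 1/2"
  shows "(cmod (w - a + cnj a * w\<^sup>2))\<^sup>2 \<le> 1 + 4 * (cmod a)\<^sup>2"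
proof -
  define r where "r = Re (cnj a * w)"
  have w2: "(cmod w)\<^sup>2 \<le> 1" using w by (simp add: power_le_one)
  have "cmod (cnj a * w\<^sup>2 - a) \<le> cmod a * (cmod w)\<^sup>2 + cmod a"
    using norm_triangle_ineq4[of "cnj a * w\<^sup>2" a] by (simp add: norm_mult norm_power)
  also have "\<dots> \<le> 2 * cmod a"
    using mult_left_mono[OF w2, of "cmod a"] by simp
  finally have sq: "(cmod (cnj a * w\<^sup>2 - a))\<^sup>2 \<le> 4 * (cmod a)\<^sup>2"
    using power_mono[of _ _ 2] by fastforce
  have "\<bar>r\<bar> \<le> cmod a * cmod w"
    unfolding r_def using abs_Re_le_cmod[of "cnj a * w"] by (simp add: norm_mult)
  also have "\<dots> \<le> (1/2) * 1" by (intro mult_mono a w) auto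
  finally have "- 2 * r \<le> 1" by simp
  \<comment> \<open>The left side is the cross term of the expanded square. Bounding it by 1 - |w|^2
    completes |w|^2 to 1, so only a term quadratic in a remains.\<close>
  then have "(1 - (cmod w)\<^sup>2) * (- 2 * r) \<le> (1 - (cmod w)\<^sup>2) * 1"
    by (intro mult_left_mono) (use w2 in auto)
  with sq have "(cmod w)\<^sup>2 + (cmod (cnj a * w\<^sup>2 - a))\<^sup>2 + (1 - (cmod w)\<^sup>2) * (- 2 * r)
      \<le> (cmod w)\<^sup>2 + 4 * (cmod a)\<^sup>2 + (1 - (cmod w)\<^sup>2) * 1"
    by (intro add_mono order_refl)
  moreover have "(cmod (w - a + cnj a * w\<^sup>2))\<^sup>2
      = (cmod w)\<^sup>2 + (cmod (cnj a * w\<^sup>2 - a))\<^sup>2 + (1 - (cmod w)\<^sup>2) * (- 2 * r)"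
    unfolding r_def cmod_power2 by (simp add: power2_eq_square algebra_simps)
  ultimately show ?thesis by simp
qed

text \<open>With v = cnj a M x, expanding the square in \<open>moebius\<close> gives the first-order
  term 2 (M x \<bullet> M v) - 2 (a x \<bullet> M x), and near-extremality replaces M x \<bullet> M
  v by K^2 (a x \<bullet> M x). The errors are s^2 from the gap, 2 K^2 s^2 from this replacement and
  4 K^2 s^2 from \<open>moebius\<close>.\<close>

lemma inner_near_extremal:
  fixes M :: "complex^'n^'n"
  assumes bound: "\<And>v. norm (M *v v) \<le> K * norm v"
    and x: "norm x \<le> 1" and s: "0 \<le> s" "K\<^sup>2 - s\<^sup>2 \<le> (norm (M *v x))\<^sup>2" and a: "cmod a \<le> s"
    and K: "0 \<le> K"
    and moebius: "norm (M *v x - a *s x + cnj a *s (M *v (M *v x))) ^ 2 \<le> K\<^sup>2 * (1 + 4 * s\<^sup>2)"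
  shows "2 * (K\<^sup>2 - 1) * ((a *s x) \<bullet> (M *v x)) \<le> (1 + 6 * K\<^sup>2) * s\<^sup>2"
proof -
  define y where "y = M *v x"
  define v where "v = cnj a *s y"
  have Mv: "M *v v = cnj a *s (M *v y)"
    by (simp add: v_def vector_scalar_commute)
  have xv: "x \<bullet> v = (a *s x) \<bullet> y"
    by (simp add: v_def inner_vector_scalar_mult_left)
  have "norm y \<le> K" using bound[of x] mult_left_mono[OF x K] by (simp add: y_def)
  then have normv: "norm v \<le> s * K"
    unfolding v_def norm_vector_scalar_mult using a s by (auto intro!: mult_mono)
  \<comment> \<open>The defect of x is at most s^2, and that of v at most K^4 s^2 since |v| <= s K.
    A gap of order s^2 is what makes this error second order too.\<close>
  have "(K\<^sup>2 * (x \<bullet> v) - y \<bullet> (M *v v))\<^sup>2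
      \<le> (K\<^sup>2 * (norm x)\<^sup>2 - (norm y)\<^sup>2) * (K\<^sup>2 * (norm v)\<^sup>2 - (norm (M *v v))\<^sup>2)"
    unfolding y_def
    by (rule Cauchy_Schwarz_defect[OF bounded_linear.linear[OF bounded_linear_matrix_mult_vec] bound])
  also have "\<dots> \<le> s\<^sup>2 * (K\<^sup>2 * (norm v)\<^sup>2)"
  proof (rule mult_mono)
    have "K\<^sup>2 * (norm x)\<^sup>2 \<le> K\<^sup>2 * 1" by (intro mult_left_mono) (use x in \<open>auto simp: power_le_one\<close>)
    then show "K\<^sup>2 * (norm x)\<^sup>2 - (norm y)\<^sup>2 \<le> s\<^sup>2" using s by (simp add: y_def)
    show "0 \<le> K\<^sup>2 * (norm v)\<^sup>2 - (norm (M *v v))\<^sup>2"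
      using power_mono[OF bound[of v], of 2] by (simp add: power_mult_distrib)
  qed auto
  also have "\<dots> \<le> s\<^sup>2 * (K\<^sup>2 * (s * K)\<^sup>2)"
    by (intro mult_left_mono power_mono normv) auto
  also have "\<dots> = (K\<^sup>2 * s\<^sup>2)\<^sup>2" by (simp add: power2_eq_square algebra_simps)
  finally have "K\<^sup>2 * (x \<bullet> v) - y \<bullet> (M *v v) \<le> K\<^sup>2 * s\<^sup>2"
    by (rule power2_le_imp_le) simp
  moreover have "(norm y)\<^sup>2 + 2 * (y \<bullet> (M *v v)) - 2 * ((a *s x) \<bullet> y)
      \<le> norm (y + (M *v v - a *s x)) ^ 2"
    using zero_le_power2[of "norm (M *v v - a *s x)"]
    unfolding power2_norm_eq_inner
    by (simp add: inner_add_left inner_add_right inner_diff_left inner_diff_right inner_commute algebra_simps)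
  moreover have "norm (y + (M *v v - a *s x)) ^ 2 \<le> K\<^sup>2 * (1 + 4 * s\<^sup>2)"
    using moebius by (simp add: Mv y_def algebra_simps)
  ultimately show ?thesis
    using s by (simp add: xv y_def algebra_simps)
qed

section \<open>The supremum norm, and boundedness of \<theta>\<close>

lemma uniform_algebra_bdd_above:
  fixes A :: "('x::t2_space \<Rightarrow> complex) set"
  assumes "uniform_algebra A" "f \<in> A"
  shows "bdd_above (range (\<lambda>x. cmod (f x)))"
proof -
  have "compact (range (\<lambda>x. cmod (f x)))"
    using assms by (intro compact_continuous_image continuous_intros) (auto simp: uniform_algebra_def)
  then show ?thesis by (intro bounded_imp_bdd_above compact_imp_bounded)
qed

lemma cmod_le_supn:
  assumes "uniform_algebra A" "f \<in> A"
  shows "cmod (f x) \<le> supn f"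
  unfolding supn_def by (rule cSUP_upper[OF _ uniform_algebra_bdd_above[OF assms]]) simp

lemma supn_leI: "(\<And>x. cmod (f x) \<le> c) \<Longrightarrow> supn f \<le> c"
  unfolding supn_def by (rule cSUP_least) auto

lemma supn_scale_inverse:
  assumes "uniform_algebra A" "f \<in> A" "0 < r"
  shows "supn (\<lambda>x. complex_of_real (1 / r) * f x) \<le> supn f / r"
  using assms cmod_le_supn[OF assms(1,2)]
  by (intro supn_leI) (auto simp: norm_mult norm_divide divide_right_mono)

text \<open>If values above (k+1)^2 occurred on the unit ball, dividing those functions by k+1 would
  give a uniform null sequence whose images still exceed k+1, whereas convergent images are
  bounded.\<close>

lemma homomorphism_bdd_above:
  fixes \<theta> :: "('x::t2_space \<Rightarrow> complex) \<Rightarrow> complex^'n::finite^'n"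
  assumes UA: "uniform_algebra A"
    and scale: "\<And>c f. f \<in> A \<Longrightarrow> \<theta> (\<lambda>x. c * f x) = cmat_scale c (\<theta> f)"
    and cont: "\<And>F f. (\<And>k. F k \<in> A) \<Longrightarrow> f \<in> A \<Longrightarrow> uniform_limit UNIV F f sequentially
      \<Longrightarrow> (\<lambda>k. \<theta> (F k)) \<longlonglongrightarrow> \<theta> f"
  shows "bdd_above {norm (\<theta> f *v x) | f x. f \<in> A \<and> supn f \<le> 1 \<and> norm x \<le> 1}"
proof (rule ccontr)
  assume unbdd: "\<not> ?thesis"
  have "\<exists>f x. f \<in> A \<and> supn f \<le> 1 \<and> norm x \<le> 1 \<and> (real (Suc k))\<^sup>2 < norm (\<theta> f *v x)" for k
    using unbdd unfolding bdd_above_def not_ex not_all not_imp Bex_def Ball_def not_le mem_Collect_eq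
    by (metis (lifting))
  then obtain f x where f: "\<And>k. f k \<in> A" and f1: "\<And>k. supn (f k) \<le> 1"
    and x: "\<And>k. norm (x k) \<le> 1"
    and big: "\<And>k. (real (Suc k))\<^sup>2 < norm (\<theta> (f k) *v x k)"
    by metis
  define F where "F k = (\<lambda>y. complex_of_real (1 / real (Suc k)) * f k y)" for k
  have A_scale: "\<And>c g. g \<in> A \<Longrightarrow> (\<lambda>y. c * g y) \<in> A"
    and A_const: "\<And>c. (\<lambda>y. c) \<in> A"
    using UA by (auto simp: uniform_algebra_def)
  have FA: "F k \<in> A" for k unfolding F_def by (rule A_scale[OF f])
  have small: "cmod (F k y) \<le> inverse (real (Suc k))" for k y
    using cmod_le_supn[OF UA FA, of k y] supn_scale_inverse[OF UA f, of "real (Suc k)" k]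
      divide_right_mono[OF f1, of "real (Suc k)" k]
    by (simp add: F_def inverse_eq_divide)
  have "uniform_limit UNIV F (\<lambda>y. 0) sequentially"
  proof (rule uniform_limitI)
    fix e :: real
    assume "0 < e"
    then have "\<forall>\<^sub>F k in sequentially. inverse (real (Suc k)) < e"
      using LIMSEQ_inverse_real_of_nat by (rule order_tendstoD(2)[rotated])
    then show "\<forall>\<^sub>F k in sequentially. \<forall>y\<in>UNIV. dist (F k y) 0 < e"
      by eventually_elim (auto intro: le_less_trans[OF small])
  qed
  then have "(\<lambda>k. \<theta> (F k)) \<longlonglongrightarrow> \<theta> (\<lambda>y. 0)"
    by (intro cont FA A_const)
  then have "Bseq (\<lambda>k. \<theta> (F k))" by (intro convergent_imp_Bseq) (auto simp: convergent_def)
  then obtain C where C: "\<And>k. norm (\<theta> (F k)) \<le> C" by (auto simp: Bseq_def)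
  \<comment> \<open>The \<open>norm\<close> of a matrix is the Euclidean norm of its entries, not
    the operator norm; any comparison constant suffices.\<close>
  obtain B where B: "0 \<le> B" "\<And>(M :: complex^'n^'n) v. norm (M *v v) \<le> norm M * norm v * B"
    using bounded_bilinear.nonneg_bounded[OF bounded_bilinear_matrix_mult_vec] by blast
  have "real (Suc k) < C * B" for k
  proof -
    have "real (Suc k) = (1 / real (Suc k)) * (real (Suc k))\<^sup>2" by (simp add: power2_eq_square)
    also have "\<dots> < (1 / real (Suc k)) * norm (\<theta> (f k) *v x k)"
      by (intro mult_strict_left_mono big) simp
    also have "\<dots> = norm (\<theta> (F k) *v x k)"
      unfolding F_def scale[OF f] cmat_scale_mult_vec norm_vector_scalar_mult
      by (simp only: norm_of_real) simp
    also have "\<dots> \<le> norm (\<theta> (F k)) * norm (x k) * B" by (rule B)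
    also have "\<dots> \<le> C * 1 * B"
      by (intro mult_right_mono mult_mono C x B order_trans[OF norm_ge_zero C]) auto
    finally show ?thesis by simp
  qed
  moreover obtain k where "C * B < real k" using reals_Archimedean2 by blast
  ultimately show False by (metis of_nat_Suc less_add_one less_trans not_less_iff_gr_or_eq add.commute)
qed

section \<open>The norm bound for \<theta>\<close>

theorem theorem1p4:
  fixes A :: "('x::t2_space \<Rightarrow> complex) set"
    and \<theta> :: "('x \<Rightarrow> complex) \<Rightarrow> complex^'n::finite^'n"
    and \<alpha> :: "('x \<Rightarrow> complex) \<Rightarrow> ('x \<Rightarrow> complex)"
  assumes UA: "uniform_algebra A"
    and \<theta>_add: "\<forall>f\<in>A. \<forall>g\<in>A. \<theta> (\<lambda>x. f x + g x) = \<theta> f + \<theta> g"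
    and \<theta>_scale: "\<forall>c. \<forall>f\<in>A. \<theta> (\<lambda>x. c * f x) = cmat_scale c (\<theta> f)"
    and \<theta>_mult: "\<forall>f\<in>A. \<forall>g\<in>A. \<theta> (\<lambda>x. f x * g x) = \<theta> f ** \<theta> g"
    and \<theta>_unital: "\<theta> (\<lambda>x. 1) = mat 1"
    and \<theta>_cont: "\<forall>F f. (\<forall>k. F k \<in> A) \<and> f \<in> A \<and> uniform_limit UNIV F f sequentially
                     \<longrightarrow> (\<lambda>k. \<theta> (F k)) \<longlonglongrightarrow> \<theta> f"
    and \<alpha>_maps: "\<forall>f\<in>A. \<alpha> f \<in> A"
    and \<alpha>_antilinear: "\<forall>c. \<forall>f\<in>A. \<forall>g\<in>A.
                        \<alpha> (\<lambda>x. c * f x + g x) = (\<lambda>x. cnj c * \<alpha> f x + \<alpha> g x)"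
    and \<alpha>_contr: "\<forall>f\<in>A. supn (\<alpha> f) \<le> supn f"
    and \<alpha>_unital: "\<alpha> (\<lambda>x. 1) = (\<lambda>x. 1)"
    and \<alpha>_const: "\<forall>f\<in>A. \<exists>c. \<alpha> f = (\<lambda>x. c)"
    and \<theta>\<alpha>_norm: "\<forall>f\<in>A. mat_opnorm (cmat_scale (1/2) (\<theta> f + adjoint_mat (\<theta> (\<alpha> f)))) \<le> supn f"
  shows "\<forall>f\<in>A. mat_opnorm (\<theta> f) \<le> 2 * supn f"
proof -
  have A_const: "\<And>c. (\<lambda>x. c) \<in> A"
    and A_add: "\<And>f g. f \<in> A \<Longrightarrow> g \<in> A \<Longrightarrow> (\<lambda>x. f x + g x) \<in> A"
    and A_mult: "\<And>f g. f \<in> A \<Longrightarrow> g \<in> A \<Longrightarrow> (\<lambda>x. f x * g x) \<in> A"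
    and A_scale: "\<And>c f. f \<in> A \<Longrightarrow> (\<lambda>x. c * f x) \<in> A"
    using UA by (auto simp: uniform_algebra_def)
  have \<theta>_const: "\<theta> (\<lambda>x. c) = cmat_scale c (mat 1)" for c
    using \<theta>_scale A_const[of 1] \<theta>_unital by force
  define S where "S = {norm (\<theta> f *v x) | f x. f \<in> A \<and> supn f \<le> 1 \<and> norm x \<le> 1}"
  define K where "K = Sup S"
  have bdd: "bdd_above S"
    unfolding S_def
    by (rule homomorphism_bdd_above[OF UA]) (use \<theta>_scale \<theta>_cont in auto)
  have S_ub: "norm (\<theta> f *v x) \<le> K" if "f \<in> A" "supn f \<le> 1" "norm x \<le> 1" for f x
    unfolding K_def by (rule cSup_upper[OF _ bdd]) (use that in \<open>auto simp: S_def\<close>)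
  have S_ne: "S \<noteq> {}"
  proof -
    have "norm (\<theta> (\<lambda>x. 0) *v 0) \<in> S"
      unfolding S_def using A_const[of 0] supn_leI[of "\<lambda>x. 0" 1]
      by (auto intro!: exI[of _ "\<lambda>x. 0"] exI[of _ 0])
    then show ?thesis by blast
  qed
  have K0: "0 \<le> K"
    using S_ub[of "\<lambda>x. 0" 0] A_const[of 0] supn_leI[of "\<lambda>x. 0" 1] by simp
  \<comment> \<open>A positive upper bound \<open>r\<close> replaces \<open>supn f\<close>, which
    may vanish and so cannot be divided by.\<close>
  have K_bound: "norm (\<theta> f *v x) \<le> K * r * norm x"
    if f: "f \<in> A" and r: "supn f \<le> r" "0 < r" for f x r
  proof (cases "x = 0")
    case False
    define y where "y = complex_of_real (1 / norm x) *s x"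
    have y: "norm y \<le> 1" using False by (simp add: y_def norm_vector_scalar_mult norm_divide)
    have "supn (\<lambda>z. complex_of_real (1 / r) * f z) \<le> 1"
      using supn_scale_inverse[OF UA f r(2)] r by (simp add: divide_le_eq order_trans)
    from S_ub[OF A_scale[OF f] this y]
    have "(1 / r) * ((1 / norm x) * norm (\<theta> f *v x)) \<le> K"
      using r False unfolding y_def \<theta>_scale[rule_format, OF f]
      by (simp add: cmat_scale_mult_vec vector_scalar_commute norm_vector_scalar_mult norm_divide
          norm_mult mult.commute)
    then show ?thesis using r False by (simp add: field_simps)
  qed simp
  have "K \<le> 2"
  proof (rule ccontr)
    assume "\<not> K \<le> 2"
    then have K2: "2 < K" by simp
    have Ksq: "4 < K\<^sup>2" using power_strict_mono[OF K2, of 2] by simp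
    \<comment> \<open>\<open>C * s\<close> will bound -2 (c x \<bullet> T x), where T = \<theta> f.
      The final estimate is K^2 - 4 <= s^2 + C s <= s (1 + C), and \<open>s\<close> is chosen to
      violate it; the cap 1/2 serves the Moebius estimate.\<close>
    define C where "C = (1 + 6 * K\<^sup>2) / (K\<^sup>2 - 1)"
    have C: "0 < C" unfolding C_def using Ksq by (intro divide_pos_pos) auto
    define s where "s = min (1/2) ((K\<^sup>2 - 4) / (2 * (1 + C)))"
    have s: "0 < s" "s \<le> 1/2" using C Ksq by (simp_all only: s_def min_less_iff_conj min.cobounded1) auto
    have "s * (1 + C) \<le> ((K\<^sup>2 - 4) / (2 * (1 + C))) * (1 + C)"
      using C by (intro mult_right_mono) (auto simp: s_def)
    also have "\<dots> = (K\<^sup>2 - 4) / 2" using C by (simp add: field_simps)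
    also have "\<dots> < K\<^sup>2 - 4" using Ksq by simp
    finally have sC: "s * (1 + C) < K\<^sup>2 - 4" .
    have s2: "s\<^sup>2 \<le> s" using s by (simp add: power2_eq_square mult_left_le)
    have "sqrt (K\<^sup>2 - s\<^sup>2) < sqrt (K\<^sup>2)" using s by (subst real_sqrt_less_iff) simp
    then have "sqrt (K\<^sup>2 - s\<^sup>2) < K" using K0 by simp
    then obtain p where "p \<in> S" "sqrt (K\<^sup>2 - s\<^sup>2) < p"
      unfolding K_def using less_cSup_iff[OF S_ne bdd] by auto
    then obtain f x where f: "f \<in> A" "supn f \<le> 1" and x: "norm x \<le> 1"
      and near: "sqrt (K\<^sup>2 - s\<^sup>2) < norm (\<theta> f *v x)"
      by (auto simp: S_def)
    have near2: "K\<^sup>2 - s\<^sup>2 \<le> (norm (\<theta> f *v x))\<^sup>2"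
      using near by (intro sqrt_le_D) simp
    obtain d where d: "\<alpha> f = (\<lambda>x. d)" using \<alpha>_const f by blast
    have "cmod d \<le> supn (\<alpha> f)"
      using cmod_le_supn[OF UA, of "\<alpha> f"] \<alpha>_maps f by (auto simp: d)
    then have d1: "cmod d \<le> 1" using \<alpha>_contr f by force
    define c where "c = cnj d"
    \<comment> \<open>The minus sign turns the upper bound on a x \<bullet> T x into a lower bound
      on c x \<bullet> T x. Contractivity of \<alpha> gives |c| <= 1, hence |a| <= s.\<close>
    define a where "a = - complex_of_real s * c"
    have a: "cmod a \<le> s" using d1 s by (simp add: a_def c_def norm_mult)
    define g where "g = (\<lambda>y. (f y + (- a)) + cnj a * (f y * f y))"
    have gA: "g \<in> A" unfolding g_def by (intro A_add A_scale A_mult A_const f)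
    \<comment> \<open>A unital homomorphism sends this polynomial in f to the same polynomial in
      T.\<close>
    have \<theta>g: "\<theta> g = (\<theta> f + cmat_scale (- a) (mat 1)) + cmat_scale (cnj a) (\<theta> f ** \<theta> f)"
      unfolding g_def
      by (simp only: \<theta>_add[rule_format] \<theta>_scale[rule_format] \<theta>_mult[rule_format] \<theta>_const
          A_add A_scale A_mult A_const f)
    have "supn g \<le> sqrt (1 + 4 * s\<^sup>2)"
    proof (rule supn_leI, rule real_le_rsqrt)
      fix y
      have "cmod (f y) \<le> 1" using cmod_le_supn[OF UA f(1), of y] f(2) by linarith
      moreover have "cmod a \<le> 1/2" using a s by linarith
      ultimately have "(cmod (g y))\<^sup>2 \<le> 1 + 4 * (cmod a)\<^sup>2"
        using cmod_moebius_linearization[of "f y" a] by (simp add: g_def power2_eq_square)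
      also have "\<dots> \<le> 1 + 4 * s\<^sup>2" using a by (simp add: power_mono)
      finally show "(cmod (g y))\<^sup>2 \<le> 1 + 4 * s\<^sup>2" .
    qed
    from K_bound[OF gA this, of x] have "norm (\<theta> g *v x) \<le> K * sqrt (1 + 4 * s\<^sup>2) * norm x"
      by (simp add: add_pos_nonneg)
    also have "\<dots> \<le> K * sqrt (1 + 4 * s\<^sup>2)"
      using x K0 by (simp add: mult_left_le)
    finally have "norm (\<theta> g *v x) ^ 2 \<le> (K * sqrt (1 + 4 * s\<^sup>2)) ^ 2"
      by (rule power_mono) simp
    then have "norm (\<theta> f *v x - a *s x + cnj a *s (\<theta> f *v (\<theta> f *v x))) ^ 2 \<le> K\<^sup>2 * (1 + 4 * s\<^sup>2)"
      by (simp add: \<theta>g power_mult_distrib matrix_vector_mult_add_rdistrib cmat_scale_mult_vec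
          matrix_vector_mul_assoc)
    then have "2 * (K\<^sup>2 - 1) * ((a *s x) \<bullet> (\<theta> f *v x)) \<le> (1 + 6 * K\<^sup>2) * s\<^sup>2"
      using K_bound[OF f(1,2)] x s near2 a K0 by (intro inner_near_extremal) auto
    moreover have "(a *s x) \<bullet> (\<theta> f *v x) = - s * ((c *s x) \<bullet> (\<theta> f *v x))"
      by (simp add: a_def inner_vec_def inner_complex_def sum_distrib_left sum_negf algebra_simps)
    \<comment> \<open>The inner product carries one factor s and the error two, so cancelling s
      leaves an error of order s.\<close>
    ultimately have "s * ((K\<^sup>2 - 1) * (- 2 * ((c *s x) \<bullet> (\<theta> f *v x)))) \<le> s * ((1 + 6 * K\<^sup>2) * s)"
      by (simp add: power2_eq_square algebra_simps)
    then have "(K\<^sup>2 - 1) * (- 2 * ((c *s x) \<bullet> (\<theta> f *v x))) \<le> (1 + 6 * K\<^sup>2) * s"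
      using s by (simp only: mult_le_cancel_left_pos)
    then have inner_c: "- 2 * ((c *s x) \<bullet> (\<theta> f *v x)) \<le> C * s"
      using Ksq by (simp add: C_def pos_le_divide_eq mult.commute)
    define N where "N = cmat_scale (1/2) (\<theta> f + adjoint_mat (\<theta> (\<alpha> f)))"
    have "N *v x = (1/2) *s (\<theta> f *v x + c *s x)"
      by (simp add: N_def d \<theta>_const adjoint_cmat_scale_one cmat_scale_mult_vec
          matrix_vector_mult_add_rdistrib c_def)
    moreover have "norm (N *v x) \<le> 1"
    proof -
      have "mat_opnorm N \<le> 1" using \<theta>\<alpha>_norm f by (force simp: N_def)
      then have "mat_opnorm N * norm x \<le> 1 * 1" using x by (intro mult_mono) auto
      then show ?thesis using norm_mult_vec_le_mat_opnorm[of N x] by linarith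
    qed
    ultimately have "norm (\<theta> f *v x + c *s x) \<le> 2"
      by (simp add: norm_vector_scalar_mult norm_divide del: vector_add_ldistrib)
    then have "norm (\<theta> f *v x + c *s x) ^ 2 \<le> 2 ^ 2" by (rule power_mono) simp
    \<comment> \<open>|c x|^2 is dropped, so only a lower bound on the inner product is
      needed.\<close>
    moreover have "(norm (\<theta> f *v x))\<^sup>2 + 2 * ((c *s x) \<bullet> (\<theta> f *v x))
        \<le> norm (\<theta> f *v x + c *s x) ^ 2"
      unfolding power2_norm_eq_inner
      by (simp add: inner_add_left inner_add_right inner_commute)
    ultimately have "K\<^sup>2 - 4 \<le> s * (1 + C)"
      using near2 inner_c s2 by (simp add: algebra_simps)
    with sC show False by simp
  qed
  show ?thesis
  proof
    fix f
    assume f: "f \<in> A"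
    have supn0: "0 \<le> supn f" using cmod_le_supn[OF UA f] norm_ge_zero order_trans by blast
    have "norm (\<theta> f *v x) \<le> 2 * supn f * norm x" for x
    proof (rule field_le_epsilon)
      fix e :: real
      assume e: "0 < e"
      \<comment> \<open>The excess keeps \<open>r\<close> positive even if
        \<open>supn f = 0\<close>; its denominator makes 2 r |x| exceed 2 \<open>supn f\<close> |x|
        by at most \<open>e\<close>.\<close>
      define r where "r = supn f + e / (2 * (1 + norm x))"
      have pos: "0 < 2 * (1 + norm x)" by (simp add: add_pos_nonneg)
      have r: "supn f \<le> r" "0 < r" using e pos supn0 by (auto simp: r_def add_nonneg_pos)
      have "norm (\<theta> f *v x) \<le> K * (r * norm x)" using K_bound[OF f r, of x] by (simp add: mult.assoc)
      also have "\<dots> \<le> 2 * (r * norm x)" using \<open>K \<le> 2\<close> r by (intro mult_right_mono) auto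
      also have "\<dots> = 2 * supn f * norm x + e * (norm x / (1 + norm x))"
        using pos by (simp add: r_def field_simps)
      also have "\<dots> \<le> 2 * supn f * norm x + e"
        using e pos by (simp add: mult_left_le divide_le_eq)
      finally show "norm (\<theta> f *v x) \<le> 2 * supn f * norm x + e" .
    qed
    then show "mat_opnorm (\<theta> f) \<le> 2 * supn f"
      unfolding mat_opnorm_def using supn0 by (intro onorm_bound) auto
  qed
qed

end
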